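(* Let $\mathbb{F}$ be a finite field, let $G(z)$ be a $k\times n$ matrix with entries in $\mathbb{F}[z]$ which is a generator matrix of a convolutional code, and let $C\subseteq\mathbb{F}[z]^n$ be the $\mathbb{F}[z]$-submodule generated by the rows of $G(z)$. Let $\mathbb{F}\hookrightarrow\mathbb{F}'$ be a finite field extension and let $C'=C\otimes_{\mathbb{F}}\mathbb{F}'\subseteq\mathbb{F}'[z]^n$ be the $\mathbb{F}'[z]$-submodule generated by the rows of $G(z)$. Then $$d_{\mathrm{free}}(C)=d_{\mathrm{free}}(C').$$
   Context: A generator matrix of a convolutional code of length $n$ and dimension $k$ is a $k\times n$ polynomial matrix whose rows are linearly independent (so that the map $\mathbb{F}[z]^k\to\mathbb{F}[z]^n$ it defines is injective). The weight of a polynomial vector is the total number of non-zero coefficients of its entries, and the free distance $d_{\mathrm{free}}$ of the code defined by a submodule $C$ of $\mathbb{F}[z]^n$ is the minimum weight of the difference of two distinct words of $C$, i.e. the minimum weight of a non-zero word of $C$ (and similarly for $C'$ over $\mathbb{F}'$). *)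

theory Defs
  imports "HOL-Analysis.Analysis" "HOL-Computational_Algebra.Polynomial"
begin

(* Linear independence of the rows as an indexed family: independence of the set
   "rows G" would not exclude repeated rows. *)
definition generator_matrix :: "'a::field poly ^ 'n ^ 'k \<Rightarrow> bool" where
  "generator_matrix G \<longleftrightarrow>
     (\<forall>u. (\<Sum>i\<in>UNIV. u i *s row i G) = 0 \<longrightarrow> (\<forall>i. u i = 0))"

lemma generator_matrix_iff_inj:
  fixes G :: "'a::field poly ^ 'n ^ 'k"
  shows "generator_matrix G \<longleftrightarrow> inj (\<lambda>u. u v* G)"
proof -
  have eq: "(\<Sum>i\<in>UNIV. u i *s row i G) = (\<chi> i. u i) v* G" for u
    by (simp add: vec_eq_iff vector_matrix_mult_def row_def)
  have diff: "(u - w) v* G = u v* G - w v* G" for u w :: "'a poly ^ 'k"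
    by (simp add: vec_eq_iff vector_matrix_mult_def algebra_simps sum_subtractf)
  show ?thesis
  proof
    assume G: "generator_matrix G"
    show "inj (\<lambda>u. u v* G)"
    proof (rule injI)
      fix u w assume "u v* G = w v* G"
      then have "(\<chi> i. (u - w) $ i) v* G = 0"
        by (simp only: vec_nth_inverse diff) simp
      then have "\<forall>i. (u - w) $ i = 0"
        using G unfolding generator_matrix_def eq by blast
      then show "u = w" by (simp add: vec_eq_iff)
    qed
  next
    assume inj: "inj (\<lambda>u. u v* G)"
    show "generator_matrix G"
      unfolding generator_matrix_def eq
    proof (intro allI impI)
      fix u i assume "(\<chi> i. u i) v* G = 0"
      also have "0 = 0 v* G" by (simp add: vec_eq_iff vector_matrix_mult_def)
      finally have "(\<chi> i. u i) = (0 :: 'a poly ^ 'k)" by (rule injD[OF inj])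
      then show "u i = 0" by (simp add: vec_eq_iff)
    qed
  qed
qed

lemma module_vec: "module ((*s) :: 'a::comm_ring_1 \<Rightarrow> 'a ^ 'n \<Rightarrow> 'a ^ 'n)"
  by unfold_locales (simp_all add: vec_eq_iff algebra_simps)

definition code_of :: "'a::field poly ^ 'n ^ 'k \<Rightarrow> ('a poly ^ 'n) set" where
  "code_of G = module.span (*s) (rows G)"

definition weight :: "'a::zero poly ^ 'n \<Rightarrow> nat" where
  "weight v = (\<Sum>j\<in>UNIV. card {m. coeff (v $ j) m \<noteq> 0})"

(* The infimum is a minimum as soon as C contains two distinct words (see below). *)
definition free_distance :: "('a::field poly ^ 'n) set \<Rightarrow> nat" where
  "free_distance C = Inf {weight (v - w) | v w. v \<in> C \<and> w \<in> C \<and> v \<noteq> w}"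

lemma free_distance_attained:
  assumes "v \<in> C" "w \<in> C" "v \<noteq> w"
  shows "\<exists>v\<in>C. \<exists>w\<in>C. v \<noteq> w \<and> free_distance C = weight (v - w)"
    and "free_distance C \<le> weight (v - w)"
proof -
  let ?S = "{weight (v - w) | v w. v \<in> C \<and> w \<in> C \<and> v \<noteq> w}"
  have wt: "weight (v - w) \<in> ?S" using assms by blast
  then have "Inf ?S \<in> ?S" by (intro Inf_nat_def1) blast
  moreover have "Inf ?S \<le> weight (v - w)" using wt by (rule cInf_lower) simp
  ultimately show "\<exists>v\<in>C. \<exists>w\<in>C. v \<noteq> w \<and> free_distance C = weight (v - w)"
    and "free_distance C \<le> weight (v - w)"
    unfolding free_distance_def by blast+
qed

lemma free_distance_submodule:
  fixes C :: "('a::field poly ^ 'n) set"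
  assumes "module.subspace (*s) C"
  shows "free_distance C = Inf (weight ` (C - {0}))"
proof -
  interpret module "(*s) :: 'a poly \<Rightarrow> 'a poly ^ 'n \<Rightarrow> 'a poly ^ 'n" by (rule module_vec)
  have "{weight (v - w) | v w. v \<in> C \<and> w \<in> C \<and> v \<noteq> w} = weight ` (C - {0})"
    (is "?L = ?R")
  proof
    show "?L \<subseteq> ?R" using subspace_diff[OF assms] by fastforce
    show "?R \<subseteq> ?L"
    proof
      fix x assume "x \<in> ?R"
      then obtain v where "v \<in> C" "v \<noteq> 0" "x = weight (v - 0)" by auto
      with subspace_0[OF assms] show "x \<in> ?L" by blast
    qed
  qed
  then show ?thesis by (simp add: free_distance_def)
qed

definition finite_field_extension :: "('a::field \<Rightarrow> 'b::field) \<Rightarrow> bool" where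
  "finite_field_extension \<iota> \<longleftrightarrow>
     \<iota> 1 = 1 \<and> (\<forall>x y. \<iota> (x + y) = \<iota> x + \<iota> y) \<and> (\<forall>x y. \<iota> (x * y) = \<iota> x * \<iota> y) \<and>
     (\<exists>B. finite_dimensional_vector_space (\<lambda>c x. \<iota> c * x) B)"

(* The image of G in the matrices over F'[z], F' being a field extension via iota. *)
definition extend_scalars ::
    "('a::field \<Rightarrow> 'b::field) \<Rightarrow> 'a poly ^ 'n ^ 'k \<Rightarrow> 'b poly ^ 'n ^ 'k" where
  "extend_scalars \<iota> G = map_matrix (map_poly \<iota>) G"

end

theory Submission
  imports Defs
begin

text \<open>
  The embedding of the ground field maps \<open>C\<close> into \<open>C'\<close> and preserves weights. Conversely, given a
  non-zero word of \<open>C'\<close>, choose an \<open>F\<close>-linear functional on \<open>F'\<close> that does not vanish at one of its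
  non-zero coefficients. Applied coefficientwise it is \<open>F[z]\<close>-linear and, since \<open>G\<close> has entries in
  \<open>F[z]\<close>, maps \<open>C'\<close> into \<open>C\<close>; it yields a non-zero word and cannot increase the weight.
\<close>

definition map_word :: "('a::zero \<Rightarrow> 'b::zero) \<Rightarrow> 'a poly ^ 'n \<Rightarrow> 'b poly ^ 'n" where
  "map_word f v = (\<chi> j. map_poly f (v $ j))"

lemma map_word_nth [simp]: "map_word f v $ j = map_poly f (v $ j)"
  by (simp add: map_word_def)

lemma row_extend_scalars: "row i (extend_scalars g G) = map_word g (row i G)"
  by (simp add: vec_eq_iff row_def extend_scalars_def map_matrix_def)

text \<open>Makes \<open>code_of G\<close> the code of an extension along the identity, so that one
  lemma can serve both inequalities.\<close>

lemma extend_scalars_id [simp]: "extend_scalars (\<lambda>x. x) G = G"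
  by (simp add: vec_eq_iff extend_scalars_def map_matrix_def poly_eq_iff coeff_map_poly)

lemma map_word_add:
  assumes "f 0 = 0" "\<And>x y. f (x + y) = f x + f y"
  shows "map_word f (v + w) = map_word f v + map_word f w"
  by (simp add: vec_eq_iff poly_eq_iff coeff_map_poly assms)

text \<open>Each coefficient of a product is a finite sum of products, and \<open>f\<close> passes
  through it by \<open>add\<close> and \<open>mult\<close>. Two cases matter: \<open>g\<close> the
  identity with \<open>f = h = \<iota>\<close>, and \<open>g = \<iota>\<close> with \<open>h\<close>
  the identity and \<open>f\<close> a functional.\<close>

lemma map_poly_semilinear_mult:
  fixes f :: "'b::comm_semiring_0 \<Rightarrow> 'c::comm_semiring_0"
  assumes zero: "f 0 = 0" "g 0 = 0" "h 0 = 0"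
    and add: "\<And>x y. f (x + y) = f x + f y"
    and mult: "\<And>x y. f (x * g y) = f x * h y"
  shows "map_poly f (p * map_poly g q) = map_poly f p * map_poly h q"
proof (rule poly_eqI)
  fix n
  have sum: "f (sum t A) = (\<Sum>i\<in>A. f (t i))" if "finite A" for t :: "nat \<Rightarrow> 'b" and A
    using that by (induction A rule: finite_induct) (simp_all add: zero add)
  show "coeff (map_poly f (p * map_poly g q)) n = coeff (map_poly f p * map_poly h q) n"
    by (simp add: coeff_map_poly zero coeff_mult sum mult)
qed

text \<open>A multiple of a row of \<open>G\<close> read through \<open>g\<close> goes to a multiple
  of the same row read through \<open>h\<close>; additivity carries this to the whole span.\<close>

lemma map_word_code_of:
  fixes f :: "'b::field \<Rightarrow> 'c::field" and g :: "'a::field \<Rightarrow> 'b" and G :: "'a poly ^ 'n ^ 'k"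
  assumes zero: "f 0 = 0" "g 0 = 0" "h 0 = 0"
    and add: "\<And>x y. f (x + y) = f x + f y"
    and mult: "\<And>x y. f (x * g y) = f x * h y"
    and v: "v \<in> code_of (extend_scalars g G)"
  shows "map_word f v \<in> code_of (extend_scalars h G)"
proof -
  interpret B: module "(*s) :: 'b poly \<Rightarrow> 'b poly ^ 'n \<Rightarrow> 'b poly ^ 'n" by (rule module_vec)
  interpret C: module "(*s) :: 'c poly \<Rightarrow> 'c poly ^ 'n \<Rightarrow> 'c poly ^ 'n" by (rule module_vec)
  let ?D = "code_of (extend_scalars h G)"
  \<comment> \<open>\<open>f\<close> need not be multiplicative, so only quantifying over all multiples of the word
    gives a submodule.\<close>
  have "\<forall>c. map_word f (c *s v) \<in> ?D"
    using v unfolding code_of_def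
  proof (rule B.span_induct)
    show "B.subspace {v. \<forall>c. map_word f (c *s v) \<in> C.span (rows (extend_scalars h G))}"
    proof (rule B.subspaceI)
      have "map_word f (c *s 0) = (0 :: 'c poly ^ 'n)" for c
        by (simp add: vec_eq_iff)
      then show "0 \<in> {v. \<forall>c. map_word f (c *s v) \<in> C.span (rows (extend_scalars h G))}"
        by (simp add: C.span_zero)
    qed (auto simp: vector_add_ldistrib map_word_add zero add vector_smult_assoc intro: C.span_add)
  next
    fix r assume "r \<in> rows (extend_scalars g G)"
    then obtain i where r: "r = map_word g (row i G)"
      by (auto simp: rows_def row_extend_scalars)
    have "map_word f (c *s r) = map_poly f c *s row i (extend_scalars h G)" for c
      by (simp add: r vec_eq_iff row_extend_scalars
          map_poly_semilinear_mult[of f g h, OF zero add mult])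
    moreover have "row i (extend_scalars h G) \<in> C.span (rows (extend_scalars h G))"
      by (rule C.span_base) (auto simp: rows_def)
    ultimately show "\<forall>c. map_word f (c *s r) \<in> C.span (rows (extend_scalars h G))"
      by (simp add: C.span_scale)
  qed
  then have "map_word f (1 *s v) \<in> ?D" by blast
  then show ?thesis by simp
qed

lemma weight_map_word_le:
  assumes "f 0 = 0"
  shows "weight (map_word f v) \<le> weight v"
  unfolding weight_def
proof (intro sum_mono card_mono)
  fix j
  \<comment> \<open>Infinite sets have \<open>card\<close> 0, so \<open>card\<close> is monotone
    only below a finite set.\<close>
  show "finite {m. coeff (v $ j) m \<noteq> 0}"
    using MOST_coeff_eq_0[of "v $ j"] by (simp add: MOST_iff_cofinite)
  show "{m. coeff (map_word f v $ j) m \<noteq> 0} \<subseteq> {m. coeff (v $ j) m \<noteq> 0}"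
    using assms by (auto simp: coeff_map_poly)
qed

text \<open>The map \<open>f\<close> may depend on \<open>a\<close>, since a fixed functional can
  kill a non-zero word; it only has to keep one non-zero coefficient of the given word
  alive.\<close>

lemma code_of_weight_le:
  fixes G :: "'a::field poly ^ 'n ^ 'k" and g :: "'a \<Rightarrow> 'b::field" and h :: "'a \<Rightarrow> 'c::field"
  assumes "g 0 = 0" "h 0 = 0"
    and functional: "\<And>a. a \<noteq> 0 \<Longrightarrow> \<exists>f. f a \<noteq> 0 \<and> f 0 = 0 \<and>
      (\<forall>x y. f (x + y) = f x + f y) \<and> (\<forall>x y. f (x * g y) = f x * h y)"
    and v: "v \<in> code_of (extend_scalars g G) - {0}"
  shows "\<exists>w \<in> code_of (extend_scalars h G) - {0}. weight w \<le> weight v"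
proof -
  obtain j m where "coeff (v $ j) m \<noteq> 0"
    using v by (auto simp: vec_eq_iff poly_eq_iff)
  then obtain f where f: "f (coeff (v $ j) m) \<noteq> 0" "f 0 = 0"
      "\<And>x y. f (x + y) = f x + f y" "\<And>x y. f (x * g y) = f x * h y"
    using functional by metis
  have "coeff (map_word f v $ j) m \<noteq> 0"
    using f by (simp add: coeff_map_poly)
  then have "map_word f v \<noteq> 0" by (metis coeff_0 zero_index)
  moreover have "map_word f v \<in> code_of (extend_scalars h G)"
    using map_word_code_of[of f g h] assms f by blast
  ultimately show ?thesis
    using weight_map_word_le[of f v] f(2) by blast
qed

lemma free_distance_code_of: "free_distance (code_of G) = Inf (weight ` (code_of G - {0}))"
proof (rule free_distance_submodule)
  show "module.subspace (*s) (code_of G)"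
    unfolding code_of_def by (rule module.subspace_span[OF module_vec])
qed

lemma Inf_image_nat_eqI:
  fixes f :: "'a \<Rightarrow> nat" and g :: "'b \<Rightarrow> nat"
  assumes le: "\<And>a. a \<in> A \<Longrightarrow> \<exists>b\<in>B. g b \<le> f a" "\<And>b. b \<in> B \<Longrightarrow> \<exists>a\<in>A. f a \<le> g b"
  shows "Inf (f ` A) = Inf (g ` B)"
proof (cases "A = {}")
  \<comment> \<open>The hypotheses force \<open>A\<close> and \<open>B\<close> to be empty together,
    and then both sides are \<open>Inf {}\<close>.\<close>
  case True
  then have "B = {}" using le(2) by blast
  with True show ?thesis by simp
next
  case False
  then have "B \<noteq> {}" using le(1) by blast
  with False show ?thesis
    by (intro antisym cINF_mono) (use le in auto)
qed

lemma finite_field_extension_functional: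
  fixes \<iota> :: "'a::field \<Rightarrow> 'b::field"
  assumes "finite_field_extension \<iota>" "a \<noteq> 0"
  shows "\<exists>f. f a \<noteq> 0 \<and> f 0 = 0 \<and>
    (\<forall>x y. f (x + y) = f x + f y) \<and> (\<forall>x y. f (x * \<iota> y) = f x * y)"
proof -
  obtain B where "finite_dimensional_vector_space (\<lambda>c x. \<iota> c * x) B"
    using assms(1) by (auto simp: finite_field_extension_def)
  then interpret E: finite_dimensional_vector_space "\<lambda>c x. \<iota> c * x" B .
  interpret K: vector_space "(*) :: 'a \<Rightarrow> 'a \<Rightarrow> 'a"
    by unfold_locales (simp_all add: algebra_simps)
  interpret vector_space_pair "\<lambda>c x. \<iota> c * x" "(*) :: 'a \<Rightarrow> 'a \<Rightarrow> 'a" ..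
  \<comment> \<open>A non-zero vector extends to a basis over the ground field, so some linear form
    takes the value 1 on it.\<close>
  have "E.independent {a}" using assms(2) by simp
  from linear_independent_extend[OF this, of "\<lambda>_. 1"]
  obtain f where "Vector_Spaces.linear (\<lambda>c x. \<iota> c * x) (*) f" and fa: "f a = 1" by auto
  then interpret f: Vector_Spaces.linear "\<lambda>c x. \<iota> c * x" "(*) :: 'a \<Rightarrow> 'a \<Rightarrow> 'a" f by simp
  have "f (x * \<iota> y) = f x * y" for x y
    using f.scale[of y x] by (simp add: mult.commute)
  then show ?thesis
    using fa f.zero f.add by (intro exI[of _ f]) simp
qed

theorem theorem3p3:
  fixes G :: "'a::{field,finite} poly ^ 'n ^ 'k"
    and \<iota> :: "'a \<Rightarrow> 'b::field"
  assumes "generator_matrix G"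
    and "finite_field_extension \<iota>"
  shows "free_distance (code_of G) = free_distance (code_of (extend_scalars \<iota> G))"
proof -
  have hom: "\<iota> 1 = 1" "\<iota> (x + y) = \<iota> x + \<iota> y" "\<iota> (x * y) = \<iota> x * \<iota> y" for x y
    using assms(2) by (auto simp: finite_field_extension_def)
  have zero: "\<iota> 0 = 0" by (metis add.right_neutral add_left_cancel hom(2))
  \<comment> \<open>\<open>\<iota>\<close> sends \<open>a * inverse a\<close> to 1, so it cannot
    send \<open>a\<close> to 0.\<close>
  have inj: "\<iota> a \<noteq> 0" if "a \<noteq> 0" for a
    using hom(1) hom(3)[of a "inverse a"] that by auto
  show ?thesis
    unfolding free_distance_code_of
  proof (rule Inf_image_nat_eqI)
    fix v assume "v \<in> code_of G - {0}"
    \<comment> \<open>Here \<open>f = \<iota>\<close> serves for every \<open>a\<close>.\<close>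
    then show "\<exists>w \<in> code_of (extend_scalars \<iota> G) - {0}. weight w \<le> weight v"
      by (intro code_of_weight_le[where g = "\<lambda>x. x"] exI[of _ \<iota>])
        (simp_all add: zero hom inj)
  next
    fix v assume v: "v \<in> code_of (extend_scalars \<iota> G) - {0}"
    \<comment> \<open>With \<open>g = \<iota>\<close> and \<open>h\<close> the identity, the maps
      required are exactly the linear functionals supplied above.\<close>
    have "\<exists>w \<in> code_of (extend_scalars (\<lambda>x. x) G) - {0}. weight w \<le> weight v"
      by (rule code_of_weight_le[OF zero refl finite_field_extension_functional[OF assms(2)] v])
    then show "\<exists>w \<in> code_of G - {0}. weight w \<le> weight v" by simp
  qed
qed

end
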